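(* Let $\mathcal{F}$ be the set of all odd closed strips and even M\"obius strips. For a graph $G$, the following statements are equivalent: 1. $G$ admits a $T_3$-free orientation. 2. There is no homomorphism $S\to G$ whenever $S\in\mathcal{F}$. 3. There is no homomorphism from an odd closed strip to $G$. 4. There is no homomorphism from an even M\"obius strip to $G$.
   Context: Graphs are finite and simple. $T_3$ is the transitive tournament on three vertices; an orientation of $G$ is $T_3$-free if it contains no induced oriented subgraph isomorphic to $T_3$ (equivalently, every triangle of $G$ is oriented cyclically). Let $P=p_1\dots p_n$ and $Q=q_1\dots q_m$ be vertex-disjoint paths ($n,m\ge 1$; a path may be a single vertex). A strip with bounding paths $P$ and $Q$ is a graph obtained from $P\cup Q$, drawn as parallel paths in the plane, by adding the edge $p_1q_1$ and the edge $p_nq_m$, and then triangulating the region between $P$ and $Q$ so that every new edge joins a vertex of $P$ to a vertex of $Q$. Equivalently, the $PQ$-edges form a sequence starting with $p_1q_1$ and ending with $p_nq_m$ in which each edge $p_iq_j$ other than the last is followed by $p_{i+1}q_j$ or by $p_iq_{j+1}$. The number of triangles of the strip is the number of $PQ$-edges minus one; the strip is even (odd) if this number is even (odd). A closed strip is obtained from a strip by identifying $p_1$ with $p_n$ and $q_1$ with $q_m$. A M\"obius strip is obtained from a strip by identifying $p_1$ with $q_m$ and $q_1$ with $p_n$. In both cases parallel edges are merged, and the identification is required not to create loops. A closed (resp. M\"obius) strip is even or odd according to whether the strip from which it is obtained is even or odd. *)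

theory Defs
  imports "Graph_Theory.Graph_Theory"
begin

text \<open>
  A finite simple graph is a \<^locale>\<open>pair_graph\<close>: a finite, loop-free, symmetric digraph in
  which the edge \<open>uv\<close> is the pair of arcs \<open>(u, v)\<close>, \<open>(v, u)\<close>.
\<close>

definition homomorphism :: "('a \<Rightarrow> 'b) \<Rightarrow> 'a pair_pre_digraph \<Rightarrow> 'b pair_pre_digraph \<Rightarrow> bool" where
  "homomorphism f G H \<longleftrightarrow>
     (\<forall>v \<in> pverts G. f v \<in> pverts H) \<and>
     (\<forall>u v. (u, v) \<in> parcs G \<longrightarrow> (f u, f v) \<in> parcs H)"

definition homomorphic :: "'a pair_pre_digraph \<Rightarrow> 'b pair_pre_digraph \<Rightarrow> bool" where
  "homomorphic G H \<longleftrightarrow> (\<exists>f. homomorphism f G H)"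


definition orientation :: "'a pair_pre_digraph \<Rightarrow> 'a pair_pre_digraph \<Rightarrow> bool" where
  "orientation D G \<longleftrightarrow> pair_digraph D \<and> asym (parcs D) \<and> mk_symmetric (with_proj D) = G"

definition T3 :: "nat pair_pre_digraph" where
  "T3 = \<lparr>pverts = {0, 1, 2}, parcs = {(0, 1), (0, 2), (1, 2)}\<rparr>"

definition T3_free :: "'a pair_pre_digraph \<Rightarrow> bool" where
  "T3_free D \<longleftrightarrow>
     \<not> (\<exists>H :: 'a pair_pre_digraph.
          induced_subgraph (with_proj H) (with_proj D) \<and> digraph_iso (with_proj T3) (with_proj H))"


text \<open>
  The vertex \<open>p\<^sub>i\<close> of \<open>P\<close> is \<open>Inl i\<close> and the vertex \<open>q\<^sub>j\<close> of \<open>Q\<close> is \<open>Inr j\<close>, with indices starting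
  at 1. The \<open>PQ\<close>-edge \<open>p\<^sub>i q\<^sub>j\<close> is encoded as the index pair \<open>(i, j)\<close>, and a strip is given by the
  sequence \<open>es\<close> of its \<open>PQ\<close>-edges.
\<close>

definition strip_seq :: "nat \<Rightarrow> nat \<Rightarrow> (nat \<times> nat) list \<Rightarrow> bool" where
  "strip_seq n m es \<longleftrightarrow>
     n \<ge> 1 \<and> m \<ge> 1 \<and> es \<noteq> [] \<and> hd es = (1, 1) \<and> last es = (n, m) \<and>
     successively (\<lambda>(i, j) e. e = (i + 1, j) \<or> e = (i, j + 1)) es"

definition strip :: "nat \<Rightarrow> nat \<Rightarrow> (nat \<times> nat) list \<Rightarrow> (nat + nat) pair_pre_digraph" where
  "strip n m es = mk_symmetric (with_proj
     \<lparr>pverts = Inl ` {1..n} \<union> Inr ` {1..m},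
      parcs = {(Inl i, Inl (i + 1)) | i. 1 \<le> i \<and> i < n}
            \<union> {(Inr j, Inr (j + 1)) | j. 1 \<le> j \<and> j < m}
            \<union> {(Inl i, Inr j) | i j. (i, j) \<in> set es}\<rparr>)"

definition triangles :: "(nat \<times> nat) list \<Rightarrow> nat" where
  "triangles es = length es - 1"


text \<open>
  Identification of vertices is the quotient by the equivalence relation generated by \<open>r\<close>. As arcs
  form a set, parallel edges are merged; an edge inside a class would become a loop.
\<close>

definition generated_equiv :: "'a set \<Rightarrow> ('a \<times> 'a) set \<Rightarrow> ('a \<times> 'a) set" where
  "generated_equiv V r = {(u, v). u \<in> V \<and> v \<in> V \<and> (u, v) \<in> (r \<union> r\<inverse>)\<^sup>*}"

definition identify :: "('a \<times> 'a) set \<Rightarrow> 'a pair_pre_digraph \<Rightarrow> 'a set pair_pre_digraph" where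
  "identify r G = (let R = generated_equiv (pverts G) r in
     \<lparr>pverts = pverts G // R,
      parcs = {(R `` {u}, R `` {v}) | u v. (u, v) \<in> parcs G}\<rparr>)"

definition closed_strip ::
    "nat \<Rightarrow> nat \<Rightarrow> (nat \<times> nat) list \<Rightarrow> (nat + nat) set pair_pre_digraph \<Rightarrow> bool" where
  "closed_strip n m es S \<longleftrightarrow>
     strip_seq n m es \<and>
     S = identify {(Inl 1, Inl n), (Inr 1, Inr m)} (strip n m es) \<and>
     pair_loopfree_digraph S"

definition mobius_strip ::
    "nat \<Rightarrow> nat \<Rightarrow> (nat \<times> nat) list \<Rightarrow> (nat + nat) set pair_pre_digraph \<Rightarrow> bool" where
  "mobius_strip n m es S \<longleftrightarrow>
     strip_seq n m es \<and>
     S = identify {(Inl 1, Inr m), (Inr 1, Inl n)} (strip n m es) \<and>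
     pair_loopfree_digraph S"

definition odd_closed_strips :: "(nat + nat) set pair_pre_digraph set" where
  "odd_closed_strips = {S. \<exists>n m es. closed_strip n m es S \<and> odd (triangles es)}"

definition even_mobius_strips :: "(nat + nat) set pair_pre_digraph set" where
  "even_mobius_strips = {S. \<exists>n m es. mobius_strip n m es S \<and> even (triangles es)}"

end

theory Submission
  imports Defs
begin

text \<open>
  In a \<open>T\<^sub>3\<close>-free orientation an arc \<open>ab\<close> forces \<open>bc\<close> for every triangle \<open>abc\<close>, so an orientation
  exists iff no arc forces its own reverse through a chain of such steps. Each step crosses one
  triangle of a strip, and crossing a triangle turns the direction of the \<open>PQ\<close>-edge around: a chain
  of length \<open>k\<close> from \<open>uv\<close> to \<open>vu\<close> is a strip with \<open>k\<close> triangles which closes up if \<open>k\<close> is odd and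
  becomes a Moebius strip if \<open>k\<close> is even. Going once around a triangle takes three steps
  and returns to the same arc, so the parity of \<open>k\<close> can be changed at will.
\<close>

subsection \<open>Strips\<close>

lemma strip_seq_single: "strip_seq 1 1 [(1, 1)]"
  by (simp add: strip_seq_def)

lemma strip_seq_snoc:
  assumes "strip_seq n m es"
  shows "strip_seq (Suc n) m (es @ [(Suc n, m)])" "strip_seq n (Suc m) (es @ [(n, Suc m)])"
  using assms by (auto simp: strip_seq_def successively_append_iff)

text \<open>Every strip arises from a single \<open>PQ\<close>-edge by adding triangles at the far
  end, so whatever compares the last \<open>PQ\<close>-edge with the first can be followed one
  triangle at a time.\<close>

lemma strip_seq_induct [consumes 1, case_names single P_step Q_step]:
  assumes "strip_seq n m es"
    and "Q 1 1 [(1, 1)]"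
    and "\<And>n m es. strip_seq n m es \<Longrightarrow> Q n m es \<Longrightarrow> Q (Suc n) m (es @ [(Suc n, m)])"
    and "\<And>n m es. strip_seq n m es \<Longrightarrow> Q n m es \<Longrightarrow> Q n (Suc m) (es @ [(n, Suc m)])"
  shows "Q n m es"
proof -
  \<comment> \<open>The bounds \<open>n \<ge> 1\<close> and \<open>m \<ge> 1\<close> are left out of
    the premises because they are not yet known for the end of the prefix; they return through
    \<open>strip_seq\<close> in the conclusion.\<close>
  have "strip_seq n m es \<and> Q n m es"
    if "es \<noteq> []" "hd es = (1, 1)" "last es = (n, m)"
      "successively (\<lambda>(i, j) e. e = (i + 1, j) \<or> e = (i, j + 1)) es"
    using that
  proof (induction es arbitrary: n m rule: rev_induct)
    case Nil
    then show ?case by simp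
  next
    case (snoc e es)
    have e: "e = (n, m)" using snoc.prems(3) by simp
    show ?case
    proof (cases "es = []")
      case True
      then have "n = 1" "m = 1" using snoc.prems(2) e by auto
      then show ?thesis using True e assms(2) strip_seq_single by simp
    next
      case False
      obtain i j where ij: "last es = (i, j)" by fastforce
      have succ: "successively (\<lambda>(i, j) e. e = (i + 1, j) \<or> e = (i, j + 1)) es"
        and step: "(n, m) = (i + 1, j) \<or> (n, m) = (i, j + 1)"
        using snoc.prems(4) False ij e by (simp_all add: successively_append_iff)
      have "strip_seq i j es" "Q i j es"
        using snoc.IH[OF False _ ij succ] snoc.prems(2) False by simp_all
      note new = strip_seq_snoc[OF this(1)] assms(3,4)[OF this]
      show ?thesis using step
      proof
        assume "(n, m) = (i + 1, j)"
        then show ?thesis using new(1,3) e by simp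
      next
        assume "(n, m) = (i, j + 1)"
        then show ?thesis using new(2,4) e by simp
      qed
    qed
  qed
  then show ?thesis using assms(1) unfolding strip_seq_def by blast
qed

lemma strip_seq_bounds:
  assumes "strip_seq n m es"
  shows "n \<ge> 1" "m \<ge> 1" "es \<noteq> []" "set es \<subseteq> {1..n} \<times> {1..m}" "(1, 1) \<in> set es" "(n, m) \<in> set es"
  using assms by (induction rule: strip_seq_induct) auto

section \<open>Arcs of strips and homomorphisms from strips\<close>

lemma parcs_mk_symmetric_with_proj: "parcs (mk_symmetric (with_proj H)) = parcs H \<union> (parcs H)\<inverse>"
  unfolding parcs_mk_symmetric by force

lemma pverts_strip: "pverts (strip n m es) = Inl ` {1..n} \<union> Inr ` {1..m}"
  by (simp add: strip_def)

lemma parcs_strip: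
  "parcs (strip n m es) =
     {(Inl i, Inl (Suc i)) | i. 1 \<le> i \<and> i < n} \<union> {(Inl (Suc i), Inl i) | i. 1 \<le> i \<and> i < n}
   \<union> {(Inr j, Inr (Suc j)) | j. 1 \<le> j \<and> j < m} \<union> {(Inr (Suc j), Inr j) | j. 1 \<le> j \<and> j < m}
   \<union> {(Inl i, Inr j) | i j. (i, j) \<in> set es} \<union> {(Inr j, Inl i) | i j. (i, j) \<in> set es}"
  unfolding strip_def parcs_mk_symmetric_with_proj by auto

lemma pair_wf_strip:
  assumes "strip_seq n m es"
  shows "pair_wf_digraph (strip n m es)"
  using strip_seq_bounds[OF assms]
  by unfold_locales (auto simp: pverts_strip parcs_strip)

text \<open>Symmetry of \<open>G\<close> lets each edge be checked in one direction only. The vertex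
  condition follows from the arcs, as every vertex of a strip lies on one: the end of a path, even
  of a single-vertex path, lies on the last \<open>PQ\<close>-edge.\<close>

lemma homomorphism_strip_iff:
  assumes "strip_seq n m es" "pair_graph G"
  shows "homomorphism f (strip n m es) G \<longleftrightarrow>
     (\<forall>i. 1 \<le> i \<and> i < n \<longrightarrow> (f (Inl i), f (Inl (Suc i))) \<in> parcs G)
   \<and> (\<forall>j. 1 \<le> j \<and> j < m \<longrightarrow> (f (Inr j), f (Inr (Suc j))) \<in> parcs G)
   \<and> (\<forall>(i, j) \<in> set es. (f (Inl i), f (Inr j)) \<in> parcs G)" (is "?L \<longleftrightarrow> ?R")
proof
  assume ?L
  then show ?R by (auto simp: homomorphism_def parcs_strip)
next
  interpret G: pair_graph G by fact
  assume R: ?R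
  have "(f u, f v) \<in> parcs G" if "(u, v) \<in> parcs (strip n m es)" for u v
    using that R by (auto simp: parcs_strip intro: G.arcs_symmetric)
  moreover have "f v \<in> pverts G" if "v \<in> pverts (strip n m es)" for v
  proof -
    have Inl: "f (Inl i) \<in> pverts G" if "1 \<le> i" "i \<le> n" for i
    proof (cases "i < n")
      case True
      then show ?thesis using R that G.in_arcsD1 by blast
    next
      case False
      then show ?thesis using R that strip_seq_bounds(6)[OF assms(1)] G.in_arcsD1 by fastforce
    qed
    moreover have "f (Inr j) \<in> pverts G" if "1 \<le> j" "j \<le> m" for j
    proof (cases "j < m")
      case True
      then show ?thesis using R that G.in_arcsD1 by blast
    next
      case False
      then show ?thesis using R that strip_seq_bounds(6)[OF assms(1)] G.in_arcsD2 by fastforce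
    qed
    ultimately show ?thesis using that by (auto simp: pverts_strip)
  qed
  ultimately show ?L by (simp add: homomorphism_def)
qed


subsection \<open>Identification of vertices\<close>

lemma equiv_generated_equiv: "equiv V (generated_equiv V r)"
proof (rule equivI)
  show "generated_equiv V r \<subseteq> V \<times> V" by (auto simp: generated_equiv_def)
  show "refl_on V (generated_equiv V r)" by (auto simp: refl_on_def generated_equiv_def)
  have "sym ((r \<union> r\<inverse>)\<^sup>*)" by (intro sym_rtrancl sym_Un_converse)
  then show "sym (generated_equiv V r)" by (auto simp: sym_def generated_equiv_def)
  show "trans (generated_equiv V r)" by (auto simp: trans_def generated_equiv_def)
qed

text \<open>The universal property of the quotient: maps out of it are the maps out of
  \<open>H\<close> that are constant on classes, and for this it suffices to be constant on the
  generating pairs.\<close>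

lemma homomorphic_identify_iff:
  assumes "pair_wf_digraph H" "r \<subseteq> pverts H \<times> pverts H"
  shows "homomorphic (identify r H) G \<longleftrightarrow>
    (\<exists>f. homomorphism f H G \<and> (\<forall>(u, v) \<in> r. f u = f v))" (is "?L \<longleftrightarrow> ?R")
proof -
  interpret H: pair_wf_digraph H by fact
  define R where "R = generated_equiv (pverts H) r"
  have eqv: "equiv (pverts H) R" unfolding R_def by (rule equiv_generated_equiv)
  have verts: "pverts (identify r H) = pverts H // R"
    and arcs: "parcs (identify r H) = {(R `` {u}, R `` {v}) | u v. (u, v) \<in> parcs H}"
    by (simp_all add: identify_def R_def Let_def)
  show ?thesis
  proof
    assume ?L
    then obtain g where g: "homomorphism g (identify r H) G" by (auto simp: homomorphic_def)
    define f where "f u = g (R `` {u})" for u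
    have "homomorphism f H G"
      using g unfolding homomorphism_def verts arcs f_def by (blast intro: quotientI)
    moreover have "f u = f v" if "(u, v) \<in> r" for u v
    proof -
      have "(u, v) \<in> R" using that assms(2) by (auto simp: R_def generated_equiv_def)
      then show ?thesis using eqv by (simp add: f_def equiv_class_eq)
    qed
    ultimately show ?R by blast
  next
    assume ?R
    then obtain f where f: "homomorphism f H G" and fr: "\<forall>(u, v) \<in> r. f u = f v" by blast
    have const: "f u = f v" if "(u, v) \<in> R" for u v
    proof -
      have "(u, v) \<in> (r \<union> r\<inverse>)\<^sup>*" using that by (simp add: R_def generated_equiv_def)
      then show ?thesis by induction (use fr in auto)
    qed
    \<comment> \<open>The choice of a representative is harmless, since \<open>f\<close> is constant
      on each class by \<open>const\<close>.\<close>
    define g where "g X = f (SOME u. u \<in> X)" for X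
    have g: "g (R `` {u}) = f u" if "u \<in> pverts H" for u
    proof -
      have "u \<in> R `` {u}" using that eqv by (rule equiv_class_self[rotated])
      then have "(SOME v. v \<in> R `` {u}) \<in> R `` {u}" by (rule someI)
      then show ?thesis using const unfolding g_def by (metis Image_singleton_iff)
    qed
    have "homomorphism g (identify r H) G"
      using f g H.in_arcsD1 H.in_arcsD2
      by (force simp: homomorphism_def verts arcs elim!: quotientE)
    then show ?L by (auto simp: homomorphic_def)
  qed
qed

text \<open>A homomorphism would carry a loop of the quotient to a loop of \<open>G\<close>. Hence
  the ban on loops in the definitions of the two strip families costs nothing once a map to
  \<open>G\<close> is given.\<close>

lemma pair_loopfree_identify:
  assumes "pair_wf_digraph H" "pair_loopfree_digraph G" "homomorphic (identify r H) G"
  shows "pair_loopfree_digraph (identify r H)"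
proof -
  interpret H: pair_wf_digraph H by fact
  interpret G: pair_loopfree_digraph G by fact
  from assms(3) obtain g where g: "homomorphism g (identify r H) G" by (auto simp: homomorphic_def)
  show ?thesis
  proof
    fix e assume e: "e \<in> parcs (identify r H)"
    obtain u v where "(u, v) \<in> parcs H" "e = (generated_equiv (pverts H) r `` {u}, generated_equiv (pverts H) r `` {v})"
      using e by (auto simp: identify_def Let_def)
    then show "fst e \<in> pverts (identify r H)" "snd e \<in> pverts (identify r H)"
      using H.in_arcsD1 H.in_arcsD2 by (simp_all add: identify_def Let_def quotientI)
    have "(g (fst e), g (snd e)) \<in> parcs G"
      using e g by (cases e) (auto simp: homomorphism_def)
    then show "fst e \<noteq> snd e" using G.no_loops' by force
  qed
qed

lemma homomorphic_identified_strip_iff: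
  assumes "pair_graph G" "strip_seq n m es" "r \<subseteq> pverts (strip n m es) \<times> pverts (strip n m es)"
  shows "pair_loopfree_digraph (identify r (strip n m es)) \<and> homomorphic (identify r (strip n m es)) G
    \<longleftrightarrow> (\<exists>f. homomorphism f (strip n m es) G \<and> (\<forall>(u, v) \<in> r. f u = f v))"
proof -
  interpret pair_graph G by fact
  show ?thesis
    using homomorphic_identify_iff[OF pair_wf_strip[OF assms(2)] assms(3), of G]
      pair_loopfree_identify[OF pair_wf_strip[OF assms(2)] pair_loopfree_digraph_axioms, of r]
    by blast
qed

section \<open>The two strip families in terms of maps of plain strips\<close>

lemma even_triangles_iff:
  assumes "strip_seq n m es"
  shows "even (triangles es) \<longleftrightarrow> odd (length es)"
  using strip_seq_bounds(3)[OF assms] by (cases es) (auto simp: triangles_def)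

text \<open>Removes the quotient graphs: from here on only maps of plain strips with matching ends
  matter. The parity is that of the number of \<open>PQ\<close>-edges, one more than the number of
  triangles.\<close>

lemma ex_homomorphic_odd_closed_iff:
  assumes "pair_graph G"
  shows "(\<exists>S \<in> odd_closed_strips. homomorphic S G) \<longleftrightarrow>
    (\<exists>n m es f. strip_seq n m es \<and> even (length es) \<and> homomorphism f (strip n m es) G
      \<and> f (Inl n) = f (Inl 1) \<and> f (Inr m) = f (Inr 1))"
proof -
  have "(\<exists>S \<in> odd_closed_strips. homomorphic S G) \<longleftrightarrow>
    (\<exists>n m es. strip_seq n m es \<and> even (length es)
      \<and> pair_loopfree_digraph (identify {(Inl 1, Inl n), (Inr 1, Inr m)} (strip n m es))
      \<and> homomorphic (identify {(Inl 1, Inl n), (Inr 1, Inr m)} (strip n m es)) G)"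
    unfolding odd_closed_strips_def closed_strip_def using even_triangles_iff by blast
  also have "\<dots> \<longleftrightarrow> (\<exists>n m es. strip_seq n m es \<and> even (length es)
      \<and> (\<exists>f. homomorphism f (strip n m es) G \<and> f (Inl n) = f (Inl 1) \<and> f (Inr m) = f (Inr 1)))"
  proof (intro ex_cong1 conj_cong refl)
    fix n m es assume seq: "strip_seq n m es"
    then have "{(Inl 1, Inl n), (Inr 1, Inr m)} \<subseteq> pverts (strip n m es) \<times> pverts (strip n m es)"
      using strip_seq_bounds[OF seq] by (auto simp: pverts_strip)
    from homomorphic_identified_strip_iff[OF assms seq this]
    show "pair_loopfree_digraph (identify {(Inl 1, Inl n), (Inr 1, Inr m)} (strip n m es))
        \<and> homomorphic (identify {(Inl 1, Inl n), (Inr 1, Inr m)} (strip n m es)) G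
      \<longleftrightarrow> (\<exists>f. homomorphism f (strip n m es) G \<and> f (Inl n) = f (Inl 1) \<and> f (Inr m) = f (Inr 1))"
      by (auto simp: eq_commute)
  qed
  finally show ?thesis by blast
qed

lemma ex_homomorphic_even_mobius_iff:
  assumes "pair_graph G"
  shows "(\<exists>S \<in> even_mobius_strips. homomorphic S G) \<longleftrightarrow>
    (\<exists>n m es f. strip_seq n m es \<and> odd (length es) \<and> homomorphism f (strip n m es) G
      \<and> f (Inl n) = f (Inr 1) \<and> f (Inr m) = f (Inl 1))"
proof -
  have "(\<exists>S \<in> even_mobius_strips. homomorphic S G) \<longleftrightarrow>
    (\<exists>n m es. strip_seq n m es \<and> odd (length es)
      \<and> pair_loopfree_digraph (identify {(Inl 1, Inr m), (Inr 1, Inl n)} (strip n m es))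
      \<and> homomorphic (identify {(Inl 1, Inr m), (Inr 1, Inl n)} (strip n m es)) G)"
    unfolding even_mobius_strips_def mobius_strip_def using even_triangles_iff by blast
  also have "\<dots> \<longleftrightarrow> (\<exists>n m es. strip_seq n m es \<and> odd (length es)
      \<and> (\<exists>f. homomorphism f (strip n m es) G \<and> f (Inl n) = f (Inr 1) \<and> f (Inr m) = f (Inl 1)))"
  proof (intro ex_cong1 conj_cong refl)
    fix n m es assume seq: "strip_seq n m es"
    then have "{(Inl 1, Inr m), (Inr 1, Inl n)} \<subseteq> pverts (strip n m es) \<times> pverts (strip n m es)"
      using strip_seq_bounds[OF seq] by (auto simp: pverts_strip)
    from homomorphic_identified_strip_iff[OF assms seq this]
    show "pair_loopfree_digraph (identify {(Inl 1, Inr m), (Inr 1, Inl n)} (strip n m es))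
        \<and> homomorphic (identify {(Inl 1, Inr m), (Inr 1, Inl n)} (strip n m es)) G
      \<longleftrightarrow> (\<exists>f. homomorphism f (strip n m es) G \<and> f (Inl n) = f (Inr 1) \<and> f (Inr m) = f (Inl 1))"
      by (auto simp: eq_commute)
  qed
  finally show ?thesis by blast
qed

subsection \<open>Orientations without transitive triangles\<close>

text \<open>Works on bare arc sets: \<open>A\<close> is meant as the symmetric arc set of the graph,
  so \<open>(w, u) \<in> A\<close> says only that the path \<open>u v w\<close> closes up to a
  triangle, and the conclusion fixes the direction.\<close>

definition cyclic_triangles :: "'a rel \<Rightarrow> 'a rel \<Rightarrow> bool" where
  "cyclic_triangles A D \<longleftrightarrow> (\<forall>u v w. (u, v) \<in> D \<and> (v, w) \<in> D \<and> (w, u) \<in> A \<longrightarrow> (w, u) \<in> D)"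

lemma not_T3_freeI:
  assumes "pair_digraph D" and D: "{(u, v), (v, w), (u, w)} \<subseteq> parcs D" and "asym (parcs D)"
  shows "\<not> T3_free D"
proof -
  interpret pair_digraph D by fact
  have verts: "u \<in> pverts D" "v \<in> pverts D" "w \<in> pverts D" using D in_arcsD1 in_arcsD2 by auto
  have ne: "u \<noteq> v" "v \<noteq> w" "u \<noteq> w" using D no_loops' by auto
  have rev: "(v, u) \<notin> parcs D" "(w, v) \<notin> parcs D" "(w, u) \<notin> parcs D"
      "(u, u) \<notin> parcs D" "(v, v) \<notin> parcs D" "(w, w) \<notin> parcs D"
    using D \<open>asym (parcs D)\<close> by (auto dest: asymD)
  define H where "H = \<lparr>pverts = {u, v, w}, parcs = {(u, v), (u, w), (v, w)}\<rparr>"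
  \<comment> \<open>The isomorphism sends 0, 1, 2 to \<open>u\<close>, \<open>v\<close>,
    \<open>w\<close>. The copy is induced because \<open>rev\<close> excludes all other arcs among
    these vertices.\<close>
  define h where "h i = (if i = 0 then u else if i = 1 then v else w)" for i :: nat
  define hom where "hom = \<lparr>iso_verts = h, iso_arcs = map_prod h h, iso_head = snd, iso_tail = fst\<rparr>"
  have "wf_digraph (with_proj D)" ..
  moreover have "wf_digraph (with_proj H)" by unfold_locales (auto simp: H_def)
  ultimately have "induced_subgraph (with_proj H) (with_proj D)"
    using verts D rev by (auto simp: induced_subgraph_def subgraph_def H_def)
  moreover have "digraph_iso (with_proj T3) (with_proj H)"
    unfolding digraph_iso_def
  proof (intro exI conjI)
    have "wf_digraph (with_proj T3)" by unfold_locales (auto simp: T3_def)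
    then show "pre_digraph.digraph_isomorphism (with_proj T3) hom"
      using ne by (auto simp: pre_digraph.digraph_isomorphism_def T3_def hom_def h_def inj_on_def)
    show "with_proj H = app_iso hom (with_proj T3)"
      by (auto simp: with_proj_def app_iso_def H_def hom_def T3_def h_def)
  qed
  ultimately show ?thesis by (auto simp: T3_free_def)
qed

lemma T3_freeI:
  assumes "\<And>u v w. {(u, v), (v, w), (u, w)} \<subseteq> parcs D \<Longrightarrow> False"
  shows "T3_free D"
  unfolding T3_free_def
proof
  assume "\<exists>H :: 'a pair_pre_digraph.
    induced_subgraph (with_proj H) (with_proj D) \<and> digraph_iso (with_proj T3) (with_proj H)"
  then obtain H :: "'a pair_pre_digraph" and hom
    where H: "induced_subgraph (with_proj H) (with_proj D)"
      and hom: "pre_digraph.digraph_isomorphism (with_proj T3) hom"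
      and eq: "with_proj H = app_iso hom (with_proj T3)"
    by (auto simp: digraph_iso_def)
  have "(iso_verts hom i, iso_verts hom j) \<in> parcs D" if "(i, j) \<in> parcs T3" for i j
  proof -
    have "iso_arcs hom (i, j) \<in> parcs H"
      using that arg_cong[OF eq, of arcs] by simp
    \<comment> \<open>Tail and head in \<open>with_proj\<close> are the projections, so equality of
      the digraphs determines these two components and the map on arcs is induced by the map on
      vertices.\<close>
    moreover have "iso_tail hom = fst" "iso_head hom = snd"
      using arg_cong[OF eq, of tail] arg_cong[OF eq, of head] by simp_all
    ultimately have "(iso_verts hom i, iso_verts hom j) \<in> parcs H"
      using pre_digraph.iso_verts_tail[OF hom, of "(i, j)"]
        pre_digraph.iso_verts_head[OF hom, of "(i, j)"] that
      by (metis prod.collapse fst_conv snd_conv with_proj_simps(2,4,5))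
    then show ?thesis using H by (auto simp: induced_subgraph_def)
  qed
  then show False
    using assms[of "iso_verts hom 0" "iso_verts hom 1" "iso_verts hom 2"] by (simp add: T3_def)
qed

lemma ex_T3_free_orientation_iff:
  assumes "pair_graph G"
  shows "(\<exists>D. orientation D G \<and> T3_free D) \<longleftrightarrow>
    (\<exists>D. asym D \<and> D \<union> D\<inverse> = parcs G \<and> cyclic_triangles (parcs G) D)" (is "?L \<longleftrightarrow> ?R")
proof
  interpret pair_graph G by fact
  {
    assume ?L
    then obtain D where D: "pair_digraph D" "asym (parcs D)" "mk_symmetric (with_proj D) = G"
      "T3_free D" by (auto simp: orientation_def)
    have arcs: "parcs D \<union> (parcs D)\<inverse> = parcs G"
      using arg_cong[OF D(3), of parcs] by (simp only: parcs_mk_symmetric_with_proj)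
    moreover have "cyclic_triangles (parcs G) (parcs D)"
      unfolding cyclic_triangles_def
    proof (intro allI impI)
      fix u v w assume *: "(u, v) \<in> parcs D \<and> (v, w) \<in> parcs D \<and> (w, u) \<in> parcs G"
      then have "(u, w) \<notin> parcs D" using not_T3_freeI[OF D(1) _ D(2), of u v w] D(4) by auto
      then show "(w, u) \<in> parcs D" using * unfolding arcs[symmetric] by simp
    qed
    ultimately show ?R using D(2) by blast
  }
  assume ?R
  then obtain D where D: "asym D" "D \<union> D\<inverse> = parcs G" "cyclic_triangles (parcs G) D" by blast
  let ?D = "\<lparr>pverts = pverts G, parcs = D\<rparr>"
  have sub: "D \<subseteq> parcs G" using D(2) by blast
  have "pair_digraph ?D"
  proof
    show "finite (pverts ?D)" using pair_finite_verts by simp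
    show "finite (parcs ?D)" using finite_subset[OF sub pair_finite_arcs] by simp
    fix e assume "e \<in> parcs ?D"
    then have "e \<in> parcs G" using sub by auto
    then show "fst e \<in> pverts ?D" "snd e \<in> pverts ?D" "fst e \<noteq> snd e"
      using arc_fst_in_verts arc_snd_in_verts pair_no_loops by simp_all
  qed
  moreover have "mk_symmetric (with_proj ?D) = G"
    using D(2) by (intro pair_pre_digraph.equality) (simp_all add: parcs_mk_symmetric_with_proj)
  moreover have "T3_free ?D"
  proof (rule T3_freeI)
    fix u v w assume "{(u, v), (v, w), (u, w)} \<subseteq> parcs ?D"
    then have *: "(u, v) \<in> D" "(v, w) \<in> D" "(u, w) \<in> D" by simp_all
    moreover from *(3) have "(w, u) \<in> parcs G" using D(2) by blast
    ultimately have "(w, u) \<in> D" using D(3) unfolding cyclic_triangles_def by blast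
    then show False using *(3) D(1) by (blast dest: asymD)
  qed
  ultimately show ?L using D(1) by (auto simp: orientation_def)
qed


subsection \<open>Forcing\<close>

definition forcing :: "'a rel \<Rightarrow> ('a \<times> 'a) rel" where
  "forcing A = {((a, b), (b, c)) | a b c. (a, b) \<in> A \<and> (b, c) \<in> A \<and> (c, a) \<in> A}"

text \<open>Two further steps around the same triangle undo a step, so reachability is an
  equivalence relation.\<close>

lemma sym_rtrancl_forcing: "sym ((forcing A)\<^sup>*)"
proof -
  have "(y, x) \<in> (forcing A)\<^sup>*" if "(x, y) \<in> forcing A" for x y
  proof -
    from that obtain a b c where "x = (a, b)" "y = (b, c)" "(a, b) \<in> A" "(b, c) \<in> A" "(c, a) \<in> A"
      by (auto simp: forcing_def)
    then have "(y, (c, a)) \<in> forcing A" "((c, a), x) \<in> forcing A" by (auto simp: forcing_def)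
    then show ?thesis by auto
  qed
  then have "((forcing A)\<inverse>)\<^sup>* \<subseteq> (forcing A)\<^sup>*"
    by (intro rtrancl_subset_rtrancl) auto
  then show ?thesis by (auto simp: sym_conv_converse_eq rtrancl_converse)
qed

text \<open>Traversing the triangle the other way turns the step from \<open>ab\<close> to
  \<open>bc\<close> into one from \<open>cb\<close> to \<open>ba\<close>. This runs backwards, which
  symmetry of reachability repairs.\<close>

lemma forcing_swap:
  assumes "sym A" "(x, y) \<in> (forcing A)\<^sup>*"
  shows "(prod.swap x, prod.swap y) \<in> (forcing A)\<^sup>*"
  using assms(2)
proof induction
  case (step y z)
  have "(prod.swap z, prod.swap y) \<in> forcing A"
    using step.hyps(2) symD[OF \<open>sym A\<close>] unfolding forcing_def by fastforce
  then show ?case using step.IH sym_rtrancl_forcing by (metis r_into_rtrancl rtrancl_trans symD)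
qed simp

text \<open>
  The orientation picks, out of a forcing class and the class of the reversed arcs, the one
  singled out by the choice operator.
\<close>

lemma cyclic_orientation_if_no_reversal:
  assumes "sym A" and no_rev: "\<And>u v. (u, v) \<in> A \<Longrightarrow> ((u, v), (v, u)) \<notin> (forcing A)\<^sup>*"
  shows "\<exists>D. asym D \<and> D \<union> D\<inverse> = A \<and> cyclic_triangles A D"
proof -
  define C where "C e = {e'. (e, e') \<in> (forcing A)\<^sup>*}" for e
  \<comment> \<open>The choice is made from an unordered pair of classes, so both directions of an
    edge consult the same choice; \<open>C_ne\<close> then lets only one of them win.\<close>
  define pick where "pick e = (SOME X. X \<in> {C e, C (prod.swap e)})" for e
  define D where "D = {e \<in> A. C e = pick e}"
  have pick: "pick e = C e \<or> pick e = C (prod.swap e)" for e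
    using someI[of "\<lambda>X. X \<in> {C e, C (prod.swap e)}" "C e"] by (auto simp: pick_def)
  have pick_swap: "pick (prod.swap e) = pick e" for e
    by (simp add: pick_def insert_commute)
  have C_eq: "C x = C y" if "(x, y) \<in> (forcing A)\<^sup>*" for x y
    using rtrancl_trans[OF that] rtrancl_trans[OF symD[OF sym_rtrancl_forcing that]]
    unfolding C_def by (intro Collect_cong iffI)
  have C_ne: "C (u, v) \<noteq> C (v, u)" if "(u, v) \<in> A" for u v
    using no_rev[OF that] unfolding C_def by blast
  have "asym D"
  proof (rule asymI)
    fix u v assume "(u, v) \<in> D"
    then show "(v, u) \<notin> D"
      using C_ne[of u v] pick_swap[of "(u, v)"] by (simp add: D_def)
  qed
  moreover have "D \<union> D\<inverse> = A"
  proof -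
    have "(u, v) \<in> D \<or> (v, u) \<in> D" if "(u, v) \<in> A" for u v
      using that symD[OF \<open>sym A\<close> that] pick[of "(u, v)"] pick_swap[of "(u, v)"] by (auto simp: D_def)
    moreover have "D \<subseteq> A" by (auto simp: D_def)
    moreover have "D\<inverse> \<subseteq> A" using \<open>D \<subseteq> A\<close> \<open>sym A\<close> unfolding sym_conv_converse_eq by blast
    ultimately show ?thesis by auto
  qed
  moreover have "cyclic_triangles A D"
    unfolding cyclic_triangles_def
  proof (intro allI impI)
    fix u v w assume *: "(u, v) \<in> D \<and> (v, w) \<in> D \<and> (w, u) \<in> A"
    then have "((v, w), (w, u)) \<in> (forcing A)\<^sup>*" by (auto simp: forcing_def D_def)
    \<comment> \<open>Forcing preserves the class of an arc and, by \<open>forcing_swap\<close>,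
      that of its reverse, so both arcs face the same choice.\<close>
    from C_eq[OF this] C_eq[OF forcing_swap[OF \<open>sym A\<close> this]]
    have "C (w, u) = C (v, w)" "pick (w, u) = pick (v, w)" by (simp_all add: pick_def)
    then show "(w, u) \<in> D" using * by (simp add: D_def)
  qed
  ultimately show ?thesis by blast
qed

section \<open>From forcing chains to strips\<close>

text \<open>In a step from \<open>ab\<close> to \<open>bc\<close> the new vertex \<open>c\<close>
  replaces \<open>a\<close>, so it extends the path whose end is mapped to \<open>a\<close>. That
  path alternates between \<open>P\<close> and \<open>Q\<close>, which gives a zigzag strip whose
  last \<open>PQ\<close>-edge, read from \<open>P\<close> to \<open>Q\<close>, is the current arc
  for even \<open>k\<close> and its reverse for odd \<open>k\<close>.\<close>

lemma strip_if_forcing: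
  assumes "pair_graph G" "(e, e') \<in> forcing (parcs G) ^^ k" "e \<in> parcs G"
  shows "\<exists>n m es f. strip_seq n m es \<and> length es = Suc k \<and> homomorphism f (strip n m es) G
    \<and> (f (Inl 1), f (Inr 1)) = e
    \<and> (f (Inl n), f (Inr m)) = (if even k then e' else prod.swap e')"
  using assms(2)
proof (induction k arbitrary: e')
  case 0
  define f where "f = case_sum (\<lambda>_::nat. fst e) (\<lambda>_::nat. snd e)"
  have "homomorphism f (strip 1 1 [(1, 1)]) G"
    using \<open>e \<in> parcs G\<close> homomorphism_strip_iff[OF strip_seq_single assms(1)] by (simp add: f_def)
  then show ?case
    using 0 strip_seq_single by (intro exI[of _ 1] exI[of _ "[(1, 1)]"] exI[of _ f]) (simp add: f_def)
next
  case (Suc k)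
  interpret pair_graph G by fact
  obtain a b c where k: "(e, (a, b)) \<in> forcing (parcs G) ^^ k" and e': "e' = (b, c)"
    and abc: "(a, b) \<in> parcs G" "(b, c) \<in> parcs G" "(c, a) \<in> parcs G"
    using Suc.prems by (auto simp: forcing_def)
  note abc = abc abc[THEN arcs_symmetric]
  obtain n m es f where IH: "strip_seq n m es" "length es = Suc k"
    "homomorphism f (strip n m es) G" "(f (Inl 1), f (Inr 1)) = e"
    "(f (Inl n), f (Inr m)) = (if even k then (a, b) else prod.swap (a, b))"
    using Suc.IH[OF k] by blast
  note bounds = strip_seq_bounds[OF IH(1)]
  have hom: "1 \<le> i \<Longrightarrow> i < n \<Longrightarrow> (f (Inl i), f (Inl (Suc i))) \<in> parcs G"
    "1 \<le> j \<Longrightarrow> j < m \<Longrightarrow> (f (Inr j), f (Inr (Suc j))) \<in> parcs G"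
    "(i, j) \<in> set es \<Longrightarrow> (f (Inl i), f (Inr j)) \<in> parcs G" for i j
    using IH(3)[unfolded homomorphism_strip_iff[OF IH(1) assms(1)]] by blast+
  \<comment> \<open>Redefining \<open>f\<close> at the new index leaves the images of the old
    \<open>PQ\<close>-edges unchanged.\<close>
  have ne: "(Suc n, j) \<notin> set es" "(i, Suc m) \<notin> set es" for i j
    using bounds(4) by auto
  show ?case
  proof (cases "even k")
    case True
    let ?f = "f(Inl (Suc n) := c)" and ?es = "es @ [(Suc n, m)]"
    have ab: "f (Inl n) = a" "f (Inr m) = b" using IH(5) True by simp_all
    have "strip_seq (Suc n) m ?es" by (rule strip_seq_snoc(1)[OF IH(1)])
    moreover from this have "homomorphism ?f (strip (Suc n) m ?es) G"
      unfolding homomorphism_strip_iff[OF \<open>strip_seq (Suc n) m ?es\<close> assms(1)]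
      using hom ne ab abc by (auto simp: less_Suc_eq)
    moreover have "(?f (Inl 1), ?f (Inr 1)) = e" using IH(4) bounds(1) by simp
    moreover have "(?f (Inl (Suc n)), ?f (Inr m)) = (if even (Suc k) then e' else prod.swap e')"
      using True ab e' by simp
    moreover have "length ?es = Suc (Suc k)" using IH(2) by simp
    ultimately show ?thesis by blast
  next
    case False
    let ?f = "f(Inr (Suc m) := c)" and ?es = "es @ [(n, Suc m)]"
    have ab: "f (Inl n) = b" "f (Inr m) = a" using IH(5) False by simp_all
    have "strip_seq n (Suc m) ?es" by (rule strip_seq_snoc(2)[OF IH(1)])
    moreover from this have "homomorphism ?f (strip n (Suc m) ?es) G"
      unfolding homomorphism_strip_iff[OF \<open>strip_seq n (Suc m) ?es\<close> assms(1)]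
      using hom ne ab abc by (auto simp: less_Suc_eq)
    moreover have "(?f (Inl 1), ?f (Inr 1)) = e" using IH(4) bounds(2) by simp
    moreover have "(?f (Inl n), ?f (Inr (Suc m))) = (if even (Suc k) then e' else prod.swap e')"
      using False ab e' by simp
    moreover have "length ?es = Suc (Suc k)" using IH(2) by simp
    ultimately show ?thesis by blast
  qed
qed

lemma forcing_reversal_any_parity:
  assumes "u \<noteq> v" "((u, v), (v, u)) \<in> (forcing A)\<^sup>*"
  shows "\<exists>k. ((u, v), (v, u)) \<in> forcing A ^^ k \<and> even k = b"
proof -
  obtain k where k: "((u, v), (v, u)) \<in> forcing A ^^ k" using assms(2) rtrancl_power by blast
  show ?thesis
  proof (cases "even k = b")
    case False
    \<comment> \<open>A reversal needs at least one step, and the last one supplies a triangle on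
      the edge \<open>uv\<close>; a full turn around it adds three steps and flips the
      parity.\<close>
    have "k \<noteq> 0" using k assms(1) by (cases k) auto
    then obtain x where "(x, (v, u)) \<in> forcing A" using k by (metis not0_implies_Suc relpow_Suc_E)
    then obtain w where "(w, v) \<in> A" "(v, u) \<in> A" "(u, w) \<in> A" by (auto simp: forcing_def)
    then have "((v, u), (u, w)) \<in> forcing A" "((u, w), (w, v)) \<in> forcing A"
      "((w, v), (v, u)) \<in> forcing A" by (auto simp: forcing_def)
    then have "((v, u), (v, u)) \<in> forcing A ^^ 3" by (auto simp: numeral_3_eq_3)
    with k have "((u, v), (v, u)) \<in> forcing A ^^ (k + 3)" by (auto simp: relpow_add)
    then show ?thesis using False by (intro exI[of _ "k + 3"]) auto
  qed (use k in blast)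
qed


subsection \<open>Directions along a strip\<close>

lemma reverse_in_iff:
  assumes "asym D" "D \<union> D\<inverse> = A" "(u, v) \<in> A"
  shows "(v, u) \<in> D \<longleftrightarrow> (u, v) \<notin> D"
  using assms(2,3) asymD[OF assms(1)] by blast

lemma cyclic_triangles_agree:
  assumes "asym D" "D \<union> D\<inverse> = A" "cyclic_triangles A D"
    and A: "(a, b) \<in> A" "(b, c) \<in> A" "(c, a) \<in> A"
  shows "(b, c) \<in> D \<longleftrightarrow> (a, b) \<in> D"
proof -
  have cyc: "(w, u) \<in> D" if "(u, v) \<in> D" "(v, w) \<in> D" "(w, u) \<in> A" for u v w
    using that assms(3) unfolding cyclic_triangles_def by blast
  have "(b, a) \<in> A" "(c, b) \<in> A" using A assms(2) by blast+
  then show ?thesis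
    \<comment> \<open>The direction of the third edge decides: if it is \<open>ca\<close>, the first
      and third instances carry \<open>ab\<close> and \<open>bc\<close> to each other; if it is
      \<open>ac\<close>, the other two do so for the reversed arcs.\<close>
    using cyc[of c a b] cyc[of a c b] cyc[of b c a] cyc[of b a c] A
      reverse_in_iff[OF assms(1,2) A(1)] reverse_in_iff[OF assms(1,2) A(2)]
      reverse_in_iff[OF assms(1,2) A(3)]
    by argo
qed

text \<open>Crossing a triangle changes whether the \<open>PQ\<close>-edge is directed from
  \<open>P\<close> to \<open>Q\<close>. There are \<open>length es - 1\<close> crossings, so first
  and last edge agree exactly when the length is odd.\<close>

lemma strip_direction:
  assumes "strip_seq n m es" "pair_graph G" "homomorphism f (strip n m es) G"
    and "asym D" "D \<union> D\<inverse> = parcs G" "cyclic_triangles (parcs G) D"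
  shows "((f (Inl n), f (Inr m)) \<in> D \<longleftrightarrow> (f (Inl 1), f (Inr 1)) \<in> D) \<longleftrightarrow> odd (length es)"
proof -
  note agree = cyclic_triangles_agree[OF assms(4-6)] and rev = reverse_in_iff[OF assms(4,5)]
  interpret pair_graph G by fact
  \<comment> \<open>Around the triangle \<open>a b x\<close> the arcs \<open>ab\<close> and
    \<open>bx\<close> agree, so the new edge read as \<open>xb\<close> is opposite to
    \<open>ab\<close>. Here \<open>x\<close> continues \<open>P\<close>; in \<open>flip'\<close> it
    continues \<open>Q\<close>.\<close>
  have flip: "(x, b) \<in> D \<longleftrightarrow> (a, b) \<notin> D"
    if "(a, b) \<in> parcs G" "(x, b) \<in> parcs G" "(a, x) \<in> parcs G" for a b x
    using agree[of a b x] rev[of x b] that arcs_symmetric by blast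
  have flip': "(a, x) \<in> D \<longleftrightarrow> (a, b) \<notin> D"
    if "(a, b) \<in> parcs G" "(a, x) \<in> parcs G" "(b, x) \<in> parcs G" for a b x
    using agree[of x a b] rev[of a x] that arcs_symmetric by blast
  show ?thesis
    using assms(1,3)
  proof (induction rule: strip_seq_induct)
    case single
    then show ?case by simp
  next
    case (P_step n m es)
    note bounds = strip_seq_bounds[OF P_step.hyps]
    note hom = P_step.prems[unfolded homomorphism_strip_iff[OF strip_seq_snoc(1)[OF P_step.hyps] assms(2)]]
    have "homomorphism f (strip n m es) G"
      using hom by (simp add: homomorphism_strip_iff[OF P_step.hyps assms(2)])
    note IH = P_step.IH[OF this]
    have "(f (Inl (Suc n)), f (Inr m)) \<in> D \<longleftrightarrow> (f (Inl n), f (Inr m)) \<notin> D"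
      using hom bounds(1,6) by (intro flip) auto
    then show ?case using IH by auto
  next
    case (Q_step n m es)
    note bounds = strip_seq_bounds[OF Q_step.hyps]
    note hom = Q_step.prems[unfolded homomorphism_strip_iff[OF strip_seq_snoc(2)[OF Q_step.hyps] assms(2)]]
    have "homomorphism f (strip n m es) G"
      using hom by (simp add: homomorphism_strip_iff[OF Q_step.hyps assms(2)])
    note IH = Q_step.IH[OF this]
    have "(f (Inl n), f (Inr (Suc m))) \<in> D \<longleftrightarrow> (f (Inl n), f (Inr m)) \<notin> D"
      using hom bounds(2,6) by (intro flip') auto
    then show ?case using IH by auto
  qed
qed

section \<open>The two directions of the equivalence\<close>

lemma no_strips_if_orientation:
  assumes "pair_graph G" "\<exists>D. orientation D G \<and> T3_free D"
  shows "\<not> (\<exists>S \<in> odd_closed_strips. homomorphic S G)" "\<not> (\<exists>S \<in> even_mobius_strips. homomorphic S G)"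
proof -
  obtain D where D: "asym D" "D \<union> D\<inverse> = parcs G" "cyclic_triangles (parcs G) D"
    using assms ex_T3_free_orientation_iff by blast
  note dir = strip_direction[OF _ assms(1) _ D]
  \<comment> \<open>The first and last \<open>PQ\<close>-edge have the same image, hence the same
    direction, against the even length.\<close>
  show "\<not> (\<exists>S \<in> odd_closed_strips. homomorphic S G)"
    unfolding ex_homomorphic_odd_closed_iff[OF assms(1)] using dir by metis
  have "False" if "strip_seq n m es" "odd (length es)" and hom: "homomorphism f (strip n m es) G"
    "f (Inl n) = f (Inr 1)" "f (Inr m) = f (Inl 1)" for n m es f
  proof -
    have "(f (Inl 1), f (Inr 1)) \<in> parcs G"
      using hom(1) strip_seq_bounds(5)[OF that(1)] homomorphism_strip_iff[OF that(1) assms(1)] by auto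
    \<comment> \<open>The last \<open>PQ\<close>-edge is the first one reversed, and exactly one of
      the two lies in \<open>D\<close>, against the odd length.\<close>
    then show False using dir[OF that(1) hom(1)] that(2) hom(2,3) D(1,2) by (auto dest: asymD)
  qed
  then show "\<not> (\<exists>S \<in> even_mobius_strips. homomorphic S G)"
    unfolding ex_homomorphic_even_mobius_iff[OF assms(1)] by blast
qed

lemma strips_if_no_orientation:
  assumes "pair_graph G" "\<not> (\<exists>D. orientation D G \<and> T3_free D)"
  shows "\<exists>S \<in> odd_closed_strips. homomorphic S G" "\<exists>S \<in> even_mobius_strips. homomorphic S G"
proof -
  interpret pair_graph G by fact
  have "sym (parcs G)" using arcs_symmetric by (rule symI)
  from cyclic_orientation_if_no_reversal[OF this]
  obtain u v where uv: "(u, v) \<in> parcs G" "((u, v), (v, u)) \<in> (forcing (parcs G))\<^sup>*"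
    using assms(2) unfolding ex_T3_free_orientation_iff[OF assms(1)] by metis
  have ne: "u \<noteq> v" using uv(1) no_loops' by auto
  note parity = forcing_reversal_any_parity[OF ne uv(2)] and strip = strip_if_forcing[OF assms(1) _ uv(1)]
  \<comment> \<open>For odd \<open>k\<close> the swap in \<open>strip_if_forcing\<close> restores
    \<open>uv\<close>, so the ends match straight; for even \<open>k\<close>, below, they match
    crosswise.\<close>
  obtain k where k: "((u, v), (v, u)) \<in> forcing (parcs G) ^^ k" "odd k"
    using parity[of False] by blast
  obtain n m es f where S: "strip_seq n m es" "length es = Suc k" "homomorphism f (strip n m es) G"
    "(f (Inl 1), f (Inr 1)) = (u, v)" "(f (Inl n), f (Inr m)) = prod.swap (v, u)"
    using strip[OF k(1)] unfolding if_not_P[OF k(2)] by blast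
  have "even (length es)" "f (Inl n) = f (Inl 1)" "f (Inr m) = f (Inr 1)"
    using S(2,4,5) k(2) by simp_all
  then show "\<exists>S \<in> odd_closed_strips. homomorphic S G"
    unfolding ex_homomorphic_odd_closed_iff[OF assms(1)] using S(1,3) by blast
  obtain k where k: "((u, v), (v, u)) \<in> forcing (parcs G) ^^ k" "even k"
    using parity[of True] by blast
  obtain n m es f where S: "strip_seq n m es" "length es = Suc k" "homomorphism f (strip n m es) G"
    "(f (Inl 1), f (Inr 1)) = (u, v)" "(f (Inl n), f (Inr m)) = (v, u)"
    using strip[OF k(1)] unfolding if_P[OF k(2)] by blast
  have "odd (length es)" "f (Inl n) = f (Inr 1)" "f (Inr m) = f (Inl 1)"
    using S(2,4,5) k(2) by simp_all
  then show "\<exists>S \<in> even_mobius_strips. homomorphic S G"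
    unfolding ex_homomorphic_even_mobius_iff[OF assms(1)] using S(1,3) by blast
qed

theorem theorem29:
  fixes G :: "'a pair_pre_digraph"
    and \<F> :: "(nat + nat) set pair_pre_digraph set"
  assumes "pair_graph G"
    and "\<F> = odd_closed_strips \<union> even_mobius_strips"
  shows "((\<exists>D. orientation D G \<and> T3_free D) \<longleftrightarrow> (\<forall>S \<in> \<F>. \<not> homomorphic S G))
       \<and> ((\<forall>S \<in> \<F>. \<not> homomorphic S G) \<longleftrightarrow> (\<forall>S \<in> odd_closed_strips. \<not> homomorphic S G))
       \<and> ((\<forall>S \<in> odd_closed_strips. \<not> homomorphic S G) \<longleftrightarrow> (\<forall>S \<in> even_mobius_strips. \<not> homomorphic S G))"
  \<comment> \<open>With an orientation neither family maps to \<open>G\<close>; without one both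
    do. So all four statements have the same truth value.\<close>
  using no_strips_if_orientation[OF assms(1)] strips_if_no_orientation[OF assms(1)]
  unfolding assms(2) by blast

end
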